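(* There is an algorithm that, for a hypergraph $H$ with $n$ vertices and rank $3$, enumerates all minimal hitting sets of $H$ in time $O(1.6627^n)$.
   Context: A hypergraph $H=(V,E)$ consists of a finite vertex set $V$ and a collection $E$ of subsets of $V$ (hyperedges); it has rank 3 if every hyperedge has at most 3 vertices. A hitting set (transversal) of $H$ is a set $S\subseteq V$ that intersects every hyperedge; it is minimal if no proper subset of it is a hitting set. *)

theory Defs
  imports Complex_Main "HOL-Library.Landau_Symbols"
begin

definition hypergraph :: "'a set \<Rightarrow> 'a set set \<Rightarrow> bool" where
  "hypergraph V E \<longleftrightarrow> finite V \<and> (\<forall>e\<in>E. e \<subseteq> V)"

text \<open>An upper bound: smaller hyperedges, including the empty one, are allowed.\<close>

definition has_rank :: "nat \<Rightarrow> 'a set set \<Rightarrow> bool" where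
  "has_rank k E \<longleftrightarrow> (\<forall>e\<in>E. card e \<le> k)"

definition hitting_set :: "'a set \<Rightarrow> 'a set set \<Rightarrow> 'a set \<Rightarrow> bool" where
  "hitting_set V E S \<longleftrightarrow> S \<subseteq> V \<and> (\<forall>e\<in>E. S \<inter> e \<noteq> {})"

definition minimal_hitting_set :: "'a set \<Rightarrow> 'a set set \<Rightarrow> 'a set \<Rightarrow> bool" where
  "minimal_hitting_set V E S \<longleftrightarrow>
     hitting_set V E S \<and> (\<forall>S'. S' \<subset> S \<longrightarrow> \<not> hitting_set V E S')"


text \<open>
  The model of computation is first-order pure LISP: S-expressions with McCarthy's primitives
  and mutually recursive functions, where evaluating any expression node takes one step.
  Every primitive acts on a bounded number of pointers or atoms, and a fixed program has bounded
  arities and environments, so a step is a constant number of operations of a random access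
  machine with unit-cost comparison of vertex names. There is no arithmetic, and programs
  can compare and copy atoms but neither mention nor create them.
\<close>

datatype sexp = Null | Atom nat | Dot sexp sexp

datatype expr =
    EVar nat
  | ENull
  | ECons expr expr
  | ECar expr
  | ECdr expr
  | EAtom expr
  | EEq expr expr
  | EIf expr expr expr
  | ELet expr expr
  | ECall nat "expr list"

text \<open>
  A program is the list of its function bodies. In the body of a function called with
  \<open>k\<close> arguments these are \<open>EVar 0\<close> to \<open>EVar (k - 1)\<close>; \<open>ELet\<close> binds \<open>EVar 0\<close>
  and shifts the other indices. Function \<open>0\<close> is the entry point.
\<close>

type_synonym program = "expr list"

fun atomic :: "sexp \<Rightarrow> bool" where
  "atomic (Dot _ _) = False"
| "atomic _ = True"

definition sexp_of_bool :: "bool \<Rightarrow> sexp" where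
  "sexp_of_bool b = (if b then Dot Null Null else Null)"

text \<open>
  \<open>eval P \<rho> e v t\<close>: in environment \<open>\<rho>\<close>, expression \<open>e\<close> evaluates to \<open>v\<close> in exactly \<open>t\<close> steps.
  Ill-formed operations, such as the head of an atom, have no result.
\<close>

inductive eval :: "program \<Rightarrow> sexp list \<Rightarrow> expr \<Rightarrow> sexp \<Rightarrow> nat \<Rightarrow> bool"
  and eval_args :: "program \<Rightarrow> sexp list \<Rightarrow> expr list \<Rightarrow> sexp list \<Rightarrow> nat \<Rightarrow> bool"
  for P :: program where
  eval_Var: "i < length \<rho> \<Longrightarrow> eval P \<rho> (EVar i) (\<rho> ! i) 1"
| eval_Null: "eval P \<rho> ENull Null 1"
| eval_Cons: "eval P \<rho> e1 v1 t1 \<Longrightarrow> eval P \<rho> e2 v2 t2 \<Longrightarrow>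
    eval P \<rho> (ECons e1 e2) (Dot v1 v2) (t1 + t2 + 1)"
| eval_Car: "eval P \<rho> e (Dot v w) t \<Longrightarrow> eval P \<rho> (ECar e) v (t + 1)"
| eval_Cdr: "eval P \<rho> e (Dot v w) t \<Longrightarrow> eval P \<rho> (ECdr e) w (t + 1)"
| eval_Atom: "eval P \<rho> e v t \<Longrightarrow> eval P \<rho> (EAtom e) (sexp_of_bool (atomic v)) (t + 1)"
| eval_Eq: "eval P \<rho> e1 v1 t1 \<Longrightarrow> eval P \<rho> e2 v2 t2 \<Longrightarrow>
    eval P \<rho> (EEq e1 e2) (sexp_of_bool (atomic v1 \<and> v1 = v2)) (t1 + t2 + 1)"
| eval_If_true: "eval P \<rho> e0 v0 t0 \<Longrightarrow> v0 \<noteq> Null \<Longrightarrow> eval P \<rho> e1 v t \<Longrightarrow>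
    eval P \<rho> (EIf e0 e1 e2) v (t0 + t + 1)"
| eval_If_false: "eval P \<rho> e0 Null t0 \<Longrightarrow> eval P \<rho> e2 v t \<Longrightarrow>
    eval P \<rho> (EIf e0 e1 e2) v (t0 + t + 1)"
| eval_Let: "eval P \<rho> e1 v1 t1 \<Longrightarrow> eval P (v1 # \<rho>) e2 v t2 \<Longrightarrow>
    eval P \<rho> (ELet e1 e2) v (t1 + t2 + 1)"
| eval_Call: "f < length P \<Longrightarrow> eval_args P \<rho> es vs t1 \<Longrightarrow> eval P vs (P ! f) v t2 \<Longrightarrow>
    eval P \<rho> (ECall f es) v (t1 + t2 + 1)"
| eval_args_Nil: "eval_args P \<rho> [] [] 0"
| eval_args_Cons: "eval P \<rho> e v t1 \<Longrightarrow> eval_args P \<rho> es vs t2 \<Longrightarrow>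
    eval_args P \<rho> (e # es) (v # vs) (t1 + t2)"

inductive_cases evalE:
  "eval P \<rho> (EVar i) v t"
  "eval P \<rho> ENull v t"
  "eval P \<rho> (ECons e1 e2) v t"
  "eval P \<rho> (ECar e) v t"
  "eval P \<rho> (ECdr e) v t"
  "eval P \<rho> (EAtom e) v t"
  "eval P \<rho> (EEq e1 e2) v t"
  "eval P \<rho> (EIf e0 e1 e2) v t"
  "eval P \<rho> (ELet e1 e2) v t"
  "eval P \<rho> (ECall f es) v t"
  "eval_args P \<rho> [] vs t"
  "eval_args P \<rho> (e # es) vs t"

lemma eval_deterministic:
  "eval P \<rho> e v t \<Longrightarrow> eval P \<rho> e v' t' \<Longrightarrow> v' = v \<and> t' = t"
  "eval_args P \<rho> es vs s \<Longrightarrow> eval_args P \<rho> es vs' s' \<Longrightarrow> vs' = vs \<and> s' = s"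
proof (induction arbitrary: v' t' and vs' s' rule: eval_eval_args.inducts)
  case (eval_Var i \<rho>)
  then show ?case by (auto elim: evalE)
next
  case (eval_Null \<rho>)
  then show ?case by (auto elim: evalE)
next
  case (eval_Cons \<rho> e1 v1 t1 e2 v2 t2)
  from eval_Cons.prems show ?case by (auto elim!: evalE dest!: eval_Cons.IH(2,4))
next
  case (eval_Car \<rho> e v w t)
  from eval_Car.prems show ?case by (auto elim!: evalE dest!: eval_Car.IH(2))
next
  case (eval_Cdr \<rho> e v w t)
  from eval_Cdr.prems show ?case by (auto elim!: evalE dest!: eval_Cdr.IH(2))
next
  case (eval_Atom \<rho> e v t)
  from eval_Atom.prems show ?case by (auto elim!: evalE dest!: eval_Atom.IH(2))
next
  case (eval_Eq \<rho> e1 v1 t1 e2 v2 t2)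
  from eval_Eq.prems show ?case by (auto elim!: evalE dest!: eval_Eq.IH(2,4))
next
  case (eval_If_true \<rho> e0 v0 t0 e1 v t e2)
  from eval_If_true.prems eval_If_true.hyps show ?case by (auto elim!: evalE dest!: eval_If_true.IH(2,4))
next
  case (eval_If_false \<rho> e0 t0 e2 v t e1)
  from eval_If_false.prems show ?case by (auto elim!: evalE dest!: eval_If_false.IH(2,4))
next
  case (eval_Let \<rho> e1 v1 t1 e2 v t2)
  from eval_Let.prems show ?case by (auto elim!: evalE dest!: eval_Let.IH(2,4))
next
  case (eval_Call f \<rho> es vs t1 v t2)
  from eval_Call.prems show ?case by (auto elim!: evalE dest!: eval_Call.IH(3,5))
next
  case (eval_args_Nil \<rho>)
  then show ?case by (auto elim: evalE)
next
  case (eval_args_Cons \<rho> e v t1 es vs t2)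
  from eval_args_Cons.prems show ?case by (auto elim!: evalE dest!: eval_args_Cons.IH(2,4))
qed

definition runs :: "program \<Rightarrow> sexp \<Rightarrow> sexp \<Rightarrow> nat \<Rightarrow> bool" where
  "runs P x y t \<longleftrightarrow> eval P [x] (ECall 0 [EVar 0]) y t"


fun sexp_of_list :: "sexp list \<Rightarrow> sexp" where
  "sexp_of_list [] = Null"
| "sexp_of_list (x # xs) = Dot x (sexp_of_list xs)"

definition sexp_of_vertices :: "nat list \<Rightarrow> sexp" where
  "sexp_of_vertices vs = sexp_of_list (map Atom vs)"

definition sexp_of_family :: "nat list list \<Rightarrow> sexp" where
  "sexp_of_family es = sexp_of_list (map sexp_of_vertices es)"

definition sexp_of_hypergraph :: "nat list \<Rightarrow> nat list list \<Rightarrow> sexp" where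
  "sexp_of_hypergraph vs es = Dot (sexp_of_vertices vs) (sexp_of_family es)"

text \<open>Listings in an arbitrary order but without repetition.\<close>

definition lists_set :: "'a list \<Rightarrow> 'a set \<Rightarrow> bool" where
  "lists_set xs A \<longleftrightarrow> distinct xs \<and> set xs = A"

definition lists_family :: "'a list list \<Rightarrow> 'a set set \<Rightarrow> bool" where
  "lists_family xss F \<longleftrightarrow> (\<forall>xs\<in>set xss. distinct xs) \<and> lists_set (map set xss) F"

text \<open>
  \<open>T\<close> bounds the number of steps in terms of the number of vertices. Vertices are named by
  arbitrary natural numbers, not necessarily \<open>0, \<dots>, n - 1\<close>.
\<close>

definition enumerates_minimal_hitting_sets :: "nat \<Rightarrow> program \<Rightarrow> (nat \<Rightarrow> nat) \<Rightarrow> bool" where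
  "enumerates_minimal_hitting_sets k P T \<longleftrightarrow>
     (\<forall>V E vs es. hypergraph V E \<and> has_rank k E \<and> lists_set vs V \<and> lists_family es E \<longrightarrow>
        (\<exists>out t. runs P (sexp_of_hypergraph vs es) (sexp_of_family out) t \<and>
                 lists_family out {S. minimal_hitting_set V E S} \<and>
                 t \<le> T (card V)))"

end

theory Submission
  imports Defs "HOL-Real_Asymp.Real_Asymp"
begin

text \<open>
  The algorithm is Berge multiplication: add the hyperedges one at a time and maintain the list of
  minimal hitting sets. A set \<open>T\<close> meeting the new edge \<open>e\<close> is kept, any other is replaced by those
  \<open>T \<union> {v}\<close> with \<open>v \<in> e\<close> that are minimal; no set arises twice. All intermediate hypergraphs have
  rank 3, so up to a polynomial factor the running time is the maximal number of minimal hitting sets.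

  This number is at most \<open>(147/89) ^ n < 1.6517 ^ n\<close>. Branching shows that the sum of
  \<open>a ^ card S * b ^ (n - card S)\<close> over the minimal hitting sets \<open>S\<close> is at most 1 for suitable \<open>a, b\<close>.
  Now delete a random vertex set \<open>X\<close> together with all hyperedges that meet it. If \<open>X \<subseteq> S\<close> then
  \<open>S - X\<close> is a minimal hitting set of what remains; averaging the weights over \<open>X\<close>, with the density
  of \<open>X\<close> tuned to \<open>a\<close> and \<open>b\<close>, gives every \<open>S\<close> the same weight \<open>(89/147) ^ n\<close>.
\<close>

subsection \<open>Counting minimal hitting sets\<close>

text \<open>Testing the removal of single vertices suffices, since enlarging a hitting set inside
  \<open>V\<close> keeps it hitting. Removing \<open>u\<close> fails exactly when some edge meets
  \<open>S\<close> in \<open>u\<close> alone; such a private edge is easy to follow when the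
  hypergraph changes.\<close>

lemma minimal_hitting_set_iff_private:
  "minimal_hitting_set V E S \<longleftrightarrow> hitting_set V E S \<and> (\<forall>u\<in>S. \<exists>e\<in>E. S \<inter> e = {u})"
proof
  assume m: "minimal_hitting_set V E S"
  have "\<exists>e\<in>E. S \<inter> e = {u}" if u: "u \<in> S" for u
  proof -
    have "\<not> hitting_set V E (S - {u})" using m u unfolding minimal_hitting_set_def by blast
    moreover have h: "hitting_set V E S" using m unfolding minimal_hitting_set_def by blast
    ultimately obtain e where e: "e \<in> E" "(S - {u}) \<inter> e = {}" unfolding hitting_set_def by blast
    moreover have "S \<inter> e \<noteq> {}" using h e(1) unfolding hitting_set_def by blast
    ultimately show ?thesis by (intro bexI[of _ e]) auto
  qed
  then show "hitting_set V E S \<and> (\<forall>u\<in>S. \<exists>e\<in>E. S \<inter> e = {u})"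
    using m unfolding minimal_hitting_set_def by blast
next
  assume h: "hitting_set V E S \<and> (\<forall>u\<in>S. \<exists>e\<in>E. S \<inter> e = {u})"
  have "\<not> hitting_set V E S'" if S': "S' \<subset> S" for S'
  proof -
    obtain u where u: "u \<in> S" "u \<notin> S'" using S' by blast
    then obtain e where e: "e \<in> E" "S \<inter> e = {u}" using h by blast
    then have "S' \<inter> e = {}" using u S' by auto
    then show ?thesis using e(1) unfolding hitting_set_def by blast
  qed
  then show "minimal_hitting_set V E S" using h unfolding minimal_hitting_set_def by blast
qed

text \<open>A private edge of a vertex outside \<open>X\<close> avoids \<open>X\<close>, because
  \<open>X \<subseteq> S\<close>, so it survives the deletion of the edges meeting \<open>X\<close>.
  Branching takes a single vertex for \<open>X\<close>, the averaging argument an arbitrary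
  set.\<close>

lemma minimal_hitting_set_include:
  assumes "minimal_hitting_set V E S" "X \<subseteq> S"
  shows "minimal_hitting_set (V - X) {e \<in> E. e \<inter> X = {}} (S - X)"
proof -
  have h: "S \<subseteq> V" "\<And>e. e \<in> E \<Longrightarrow> S \<inter> e \<noteq> {}" "\<And>u. u \<in> S \<Longrightarrow> \<exists>e\<in>E. S \<inter> e = {u}"
    using assms(1) unfolding minimal_hitting_set_iff_private hitting_set_def by auto
  have "\<exists>e\<in>{e \<in> E. e \<inter> X = {}}. (S - X) \<inter> e = {u}" if u: "u \<in> S - X" for u
  proof -
    obtain e where "e \<in> E" "S \<inter> e = {u}" using h(3)[of u] u by blast
    then show ?thesis using u assms(2) by (intro bexI[of _ e]) auto
  qed
  moreover have "(S - X) \<inter> e \<noteq> {}" if "e \<in> E" "e \<inter> X = {}" for e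
    using h(2)[OF that(1)] that(2) by auto
  ultimately show ?thesis
    using h(1) unfolding minimal_hitting_set_iff_private hitting_set_def by auto
qed

text \<open>The traces \<open>S \<inter> e\<close> do not change when a vertex outside
  \<open>S\<close> is removed from the edges.\<close>

lemma minimal_hitting_set_exclude:
  assumes "minimal_hitting_set V E S" "a \<notin> S"
  shows "minimal_hitting_set (V - {a}) ((\<lambda>e. e - {a}) ` E) S"
proof -
  have eq: "S \<inter> (e - {a}) = S \<inter> e" for e using assms(2) by blast
  have "hitting_set V E S" and priv: "\<And>u. u \<in> S \<Longrightarrow> \<exists>e\<in>E. S \<inter> e = {u}"
    using assms(1) unfolding minimal_hitting_set_iff_private by auto
  then have "hitting_set (V - {a}) ((\<lambda>e. e - {a}) ` E) S"
    using assms(2) unfolding hitting_set_def by (simp add: eq) blast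
  then show ?thesis
    unfolding minimal_hitting_set_iff_private using priv by (simp add: eq)
qed

text \<open>
  The factors \<open>a = 21/50\<close> and \<open>b = 89/100\<close> are chosen to keep \<open>1 + (1 - a) / b\<close>, the base of the
  resulting bound, small under the two constraints \<open>3 * a * b\<^sup>2 \<le> 1\<close> (an isolated triple) and
  \<open>a + b * (a + b * a)\<^sup>2 \<le> 1\<close> (branching on a vertex of two triples). The constant \<open>7938/10000\<close>
  below is \<open>a + b * a\<close>.
\<close>

definition weight :: "'a set \<Rightarrow> 'a set set \<Rightarrow> real" where
  "weight V E = (\<Sum>S | minimal_hitting_set V E S. (21/50) ^ card S * (89/100) ^ card (V - S))"

definition rank3 :: "'a set \<Rightarrow> 'a set set \<Rightarrow> bool" where
  "rank3 V E \<longleftrightarrow> hypergraph V E \<and> has_rank 3 E"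

section \<open>Branching inequalities for the weight\<close>

lemma finite_minimal_hitting_sets: "finite V \<Longrightarrow> finite {S. minimal_hitting_set V E S}"
  by (rule finite_subset[of _ "Pow V"]) (auto simp: minimal_hitting_set_def hitting_set_def)

lemma rank3_include: "rank3 V E \<Longrightarrow> rank3 (V - X) {e \<in> E. e \<inter> X = {}}"
  unfolding rank3_def hypergraph_def has_rank_def by blast

lemma rank3_exclude:
  assumes "rank3 V E" shows "rank3 (V - {a}) ((\<lambda>e. e - {a}) ` E)"
proof -
  have "card (e - {a}) \<le> 3" if "e \<in> E" for e
    using assms that card_Diff1_le[of e a] unfolding rank3_def has_rank_def by fastforce
  then show ?thesis using assms unfolding rank3_def hypergraph_def has_rank_def by auto
qed

lemma weight_nonneg: "weight V E \<ge> 0"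
  unfolding weight_def by (intro sum_nonneg) simp

text \<open>Removing \<open>a\<close> is injective on the sets containing it and lands among the
  minimal hitting sets of what remains. Not all of those need to arise, hence only an
  inequality.\<close>

lemma weight_including_le:
  assumes "finite V" "a \<in> V"
  shows "(\<Sum>S | minimal_hitting_set V E S \<and> a \<in> S. (21/50) ^ card S * (89/100) ^ card (V - S))
    \<le> 21/50 * weight (V - {a}) {e \<in> E. e \<inter> {a} = {}}" (is "sum ?w ?A \<le> _")
proof -
  let ?w' = "\<lambda>S. (21/50) ^ card S * (89/100 :: real) ^ card (V - {a} - S)"
  have "sum ?w ?A = (\<Sum>S\<in>?A. 21/50 * ?w' (S - {a}))"
  proof (rule sum.cong)
    fix S assume "S \<in> ?A"
    then have S: "a \<in> S" "finite S" using assms(1)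
      by (auto simp: minimal_hitting_set_def hitting_set_def intro: finite_subset)
    then have "card S = Suc (card (S - {a}))" by (metis card_Suc_Diff1)
    moreover have "V - S = V - {a} - (S - {a})" using S by blast
    ultimately show "?w S = 21/50 * ?w' (S - {a})" by simp
  qed simp
  also have "\<dots> = 21/50 * sum ?w' ((\<lambda>S. S - {a}) ` ?A)"
    by (subst sum.reindex) (auto simp: sum_distrib_left inj_on_def)
  also have "sum ?w' ((\<lambda>S. S - {a}) ` ?A) \<le> weight (V - {a}) {e \<in> E. e \<inter> {a} = {}}"
    unfolding weight_def
    by (rule sum_mono2) (use assms minimal_hitting_set_include[of V E _ "{a}"] in
        \<open>auto intro: finite_minimal_hitting_sets\<close>)
  finally show ?thesis by simp
qed

lemma weight_excluding_le:
  assumes "finite V" "a \<in> V"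
  shows "(\<Sum>S | minimal_hitting_set V E S \<and> a \<notin> S. (21/50) ^ card S * (89/100) ^ card (V - S))
    \<le> 89/100 * weight (V - {a}) ((\<lambda>e. e - {a}) ` E)" (is "sum ?w ?A \<le> _")
proof -
  let ?w' = "\<lambda>S. (21/50) ^ card S * (89/100 :: real) ^ card (V - {a} - S)"
  have "sum ?w ?A = (\<Sum>S\<in>?A. 89/100 * ?w' S)"
  proof (rule sum.cong)
    fix S assume "S \<in> ?A"
    then have "a \<in> V - S" "finite (V - S)" using assms by auto
    then have "card (V - S) = Suc (card (V - S - {a}))" by (metis card_Suc_Diff1)
    moreover have "V - S - {a} = V - {a} - S" by blast
    ultimately show "?w S = 89/100 * ?w' S" by simp
  qed simp
  also have "\<dots> = 89/100 * sum ?w' ?A" by (simp add: sum_distrib_left)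
  also have "sum ?w' ?A \<le> weight (V - {a}) ((\<lambda>e. e - {a}) ` E)"
    unfolding weight_def
    by (rule sum_mono2) (use assms minimal_hitting_set_exclude[of V E] in
        \<open>auto intro: finite_minimal_hitting_sets\<close>)
  finally show ?thesis by simp
qed

lemma weight_branch:
  assumes "finite V" "a \<in> V"
  shows "weight V E \<le> 21/50 * weight (V - {a}) {e \<in> E. e \<inter> {a} = {}}
    + 89/100 * weight (V - {a}) ((\<lambda>e. e - {a}) ` E)"
proof -
  let ?M = "{S. minimal_hitting_set V E S}"
  have "weight V E = (\<Sum>S | minimal_hitting_set V E S \<and> a \<in> S. (21/50) ^ card S * (89/100) ^ card (V - S))
    + (\<Sum>S | minimal_hitting_set V E S \<and> a \<notin> S. (21/50) ^ card S * (89/100) ^ card (V - S))"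
    unfolding weight_def
    by (subst sum.union_disjoint[symmetric])
      (use finite_minimal_hitting_sets[OF assms(1), of E] in \<open>auto intro!: sum.cong\<close>)
  then show ?thesis using weight_including_le[OF assms, of E] weight_excluding_le[OF assms, of E] by linarith
qed

text \<open>A vertex in no edge has no private edge, so only the excluding branch remains.\<close>

lemma weight_isolated:
  assumes "finite V" "a \<in> V" "\<And>e. e \<in> E \<Longrightarrow> a \<notin> e"
  shows "weight V E \<le> 89/100 * weight (V - {a}) E"
proof -
  have "{S. minimal_hitting_set V E S} = {S. minimal_hitting_set V E S \<and> a \<notin> S}"
    using assms(3) unfolding minimal_hitting_set_iff_private by blast
  moreover have "(\<lambda>e. e - {a}) ` E = E" using assms(3) by (auto simp: image_iff)
  ultimately show ?thesis using weight_excluding_le[OF assms(1,2), of E] unfolding weight_def by simp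
qed

lemma weight_empty_edge: "{} \<in> E \<Longrightarrow> weight V E = 0"
  unfolding weight_def minimal_hitting_set_def hitting_set_def by (auto intro!: sum.neutral)

section \<open>Weight bounds from edges of one, two and three vertices\<close>

text \<open>The induction hypothesis of the final weight bound, for all edge sets on fewer vertices,
  so that it passes to both branches.\<close>

definition bounded_below :: "'a set \<Rightarrow> bool" where
  "bounded_below V \<longleftrightarrow> (\<forall>V' E'. rank3 V' E' \<and> card (V' :: 'a set) < card V \<longrightarrow> weight V' E' \<le> 1)"

lemma bounded_below_Diff: "finite V \<Longrightarrow> bounded_below V \<Longrightarrow> bounded_below (V - X)"
  unfolding bounded_below_def by (meson Diff_subset card_mono order_less_le_trans)

lemma weight_le_1_Diff:
  assumes "bounded_below V" "rank3 (V - {a}) E" "a \<in> V" "finite V"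
  shows "weight (V - {a}) E \<le> 1"
  using assms unfolding bounded_below_def by (metis card_Diff1_less)

lemma rank3D: "rank3 V E \<Longrightarrow> finite V" "rank3 V E \<Longrightarrow> e \<in> E \<Longrightarrow> e \<subseteq> V"
  "rank3 V E \<Longrightarrow> e \<in> E \<Longrightarrow> card e \<le> 3"
  unfolding rank3_def hypergraph_def has_rank_def by blast+

lemma exclude_edge: "e \<in> E \<Longrightarrow> e - {a} = e' \<Longrightarrow> e' \<in> (\<lambda>e. e - {a}) ` E"
  by blast

lemma include_edge: "e \<in> E \<Longrightarrow> a \<notin> e \<Longrightarrow> e \<in> {e \<in> E. e \<inter> {a} = {}}"
  by blast

text \<open>Excluding \<open>a\<close> would leave the empty edge, which has weight 0; so
  \<open>a\<close> is forced and costs the factor 21/50.\<close>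

lemma weight_singleton:
  assumes b: "bounded_below V" and r: "rank3 V E" and e: "{a} \<in> E"
  shows "weight V E \<le> 21/50"
proof -
  have a: "a \<in> V" "finite V" using rank3D[OF r] e by auto
  have "weight (V - {a}) ((\<lambda>e. e - {a}) ` E) = 0"
    by (intro weight_empty_edge exclude_edge[OF e]) simp
  then show ?thesis
    using weight_branch[OF a(2,1), of E] weight_le_1_Diff[OF b rank3_include[OF r] a] by linarith
qed

text \<open>Excluding \<open>a\<close> leaves the singleton \<open>{c}\<close>, which gives 21/50 +
  89/100 * 21/50.\<close>

lemma weight_pair:
  assumes b: "bounded_below V" and r: "rank3 V E" and e: "{a, c} \<in> E" "a \<noteq> c"
  shows "weight V E \<le> 7938/10000"
proof -
  have a: "a \<in> V" "finite V" using rank3D[OF r] e by auto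
  have "{c} \<in> (\<lambda>e. e - {a}) ` E" using e by (intro exclude_edge) auto
  then have "weight (V - {a}) ((\<lambda>e. e - {a}) ` E) \<le> 21/50"
    by (rule weight_singleton[OF bounded_below_Diff[OF a(2) b] rank3_exclude[OF r]])
  then show ?thesis
    using weight_branch[OF a(2,1), of E] weight_le_1_Diff[OF b rank3_include[OF r] a] by linarith
qed

text \<open>The singleton forces \<open>a\<close>; the pair avoids \<open>a\<close>, so it survives
  and contributes its own factor.\<close>

lemma weight_singleton_pair:
  assumes b: "bounded_below V" and r: "rank3 V E"
    and e: "{a} \<in> E" "{c, d} \<in> E" "c \<noteq> d" "a \<notin> {c, d}"
  shows "weight V E \<le> 21/50 * (7938/10000)"
proof -
  have a: "a \<in> V" "finite V" using rank3D[OF r] e by auto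
  have "weight (V - {a}) ((\<lambda>e. e - {a}) ` E) = 0"
    by (intro weight_empty_edge exclude_edge[OF e(1)]) simp
  moreover have "weight (V - {a}) {e \<in> E. e \<inter> {a} = {}} \<le> 7938/10000"
    using weight_pair[OF bounded_below_Diff[OF a(2) b] rank3_include[OF r] include_edge[OF e(2,4)] e(3)] .
  ultimately show ?thesis using weight_branch[OF a(2,1), of E] by linarith
qed

lemma weight_two_singletons:
  assumes b: "bounded_below V" and r: "rank3 V E" and e: "{a} \<in> E" "{c} \<in> E" "a \<noteq> c"
  shows "weight V E \<le> 21/50 * (21/50)"
proof -
  have a: "a \<in> V" "finite V" using rank3D[OF r] e by auto
  have "weight (V - {a}) ((\<lambda>e. e - {a}) ` E) = 0"
    by (intro weight_empty_edge exclude_edge[OF e(1)]) simp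
  moreover have "weight (V - {a}) {e \<in> E. e \<inter> {a} = {}} \<le> 21/50"
    using weight_singleton[OF bounded_below_Diff[OF a(2) b] rank3_include[OF r] include_edge[OF e(2)]] e(3)
    by simp
  ultimately show ?thesis using weight_branch[OF a(2,1), of E] by linarith
qed

text \<open>Write q = 7938/10000. Branching on \<open>a\<close> leaves either the other pair alone
  or that pair together with \<open>{c}\<close>, and 21/50 * q + 89/100 * (21/50 * q) = q^2.\<close>

lemma weight_disjoint_pairs:
  assumes b: "bounded_below V" and r: "rank3 V E"
    and e: "{a, c} \<in> E" "{d, f} \<in> E" "a \<noteq> c" "d \<noteq> f" "a \<notin> {d, f}" "c \<notin> {d, f}"
  shows "weight V E \<le> (7938/10000)\<^sup>2"
proof -
  have a: "a \<in> V" "finite V" using rank3D[OF r] e by auto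
  have b': "bounded_below (V - {a})" using bounded_below_Diff[OF a(2) b] .
  have "weight (V - {a}) {e \<in> E. e \<inter> {a} = {}} \<le> 7938/10000"
    using weight_pair[OF b' rank3_include[OF r] include_edge[OF e(2,5)] e(4)] .
  moreover have "weight (V - {a}) ((\<lambda>e. e - {a}) ` E) \<le> 21/50 * (7938/10000)"
    by (rule weight_singleton_pair[OF b' rank3_exclude[OF r] exclude_edge[OF e(1), where e' = "{c}"]
          exclude_edge[OF e(2), where e' = "{d, f}"]])
      (use e in auto)
  ultimately show ?thesis using weight_branch[OF a(2,1), of E] by (simp add: power2_eq_square)
qed

text \<open>Excluding the shared vertex forces both \<open>c\<close> and \<open>d\<close>. The sum
  21/50 + 89/100 * (21/50)^2 is about 0.577, below the 0.630 of disjoint pairs, so one bound serves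
  both cases.\<close>

lemma weight_crossing_pairs:
  assumes b: "bounded_below V" and r: "rank3 V E"
    and e: "{a, c} \<in> E" "{a, d} \<in> E" "a \<noteq> c" "a \<noteq> d" "c \<noteq> d"
  shows "weight V E \<le> (7938/10000)\<^sup>2"
proof -
  have a: "a \<in> V" "finite V" using rank3D[OF r] e by auto
  have "weight (V - {a}) ((\<lambda>e. e - {a}) ` E) \<le> 21/50 * (21/50)"
    by (rule weight_two_singletons[OF bounded_below_Diff[OF a(2) b] rank3_exclude[OF r]
          exclude_edge[OF e(1), where e' = "{c}"] exclude_edge[OF e(2), where e' = "{d}"]]) (use e in auto)
  then show ?thesis
    using weight_branch[OF a(2,1), of E] weight_le_1_Diff[OF b rank3_include[OF r] a]
    by (simp add: power2_eq_square)
qed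

lemma weight_two_pairs:
  assumes b: "bounded_below V" and r: "rank3 V E"
    and e: "e \<in> E" "e' \<in> E" "card e = 2" "card e' = 2" "e \<noteq> e'"
  shows "weight V E \<le> (7938/10000)\<^sup>2"
proof (cases "e \<inter> e' = {}")
  case True
  obtain a c d f where "e = {a, c}" "a \<noteq> c" "e' = {d, f}" "d \<noteq> f"
    using e(3,4) by (auto simp: card_2_iff)
  then show ?thesis using weight_disjoint_pairs[OF b r, of a c d f] e True by auto
next
  case False
  then obtain a where a: "a \<in> e" "a \<in> e'" by blast
  obtain c d where "e = {a, c}" "a \<noteq> c" "e' = {a, d}" "a \<noteq> d"
    using e(3,4) a by (fastforce simp: card_2_iff)
  then show ?thesis using weight_crossing_pairs[OF b r, of a c d] e by auto
qed

text \<open>Excluding \<open>a\<close> turns the triples into two distinct pairs, so the second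
  constraint on the two factors applies.\<close>

lemma weight_meeting_triples:
  assumes b: "bounded_below V" and r: "rank3 V E"
    and e: "e \<in> E" "e' \<in> E" "card e = 3" "card e' = 3" "e \<noteq> e'" "a \<in> e" "a \<in> e'"
  shows "weight V E \<le> 1"
proof -
  have a: "a \<in> V" "finite V" using rank3D[OF r] e by auto
  have "weight (V - {a}) ((\<lambda>e. e - {a}) ` E) \<le> (7938/10000)\<^sup>2"
    by (rule weight_two_pairs[OF bounded_below_Diff[OF a(2) b] rank3_exclude[OF r], where e = "e - {a}" and e' = "e' - {a}"])
      (use e in auto)
  then show ?thesis
    using weight_branch[OF a(2,1), of E] weight_le_1_Diff[OF b rank3_include[OF r] a]
    by (simp add: power2_eq_square)
qed

lemma weight_isolated_pair:
  assumes "finite V" "a \<in> V" "c \<in> V" "a \<noteq> c" "\<And>e. e \<in> E \<Longrightarrow> a \<notin> e \<and> c \<notin> e"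
  shows "weight V E \<le> (89/100)\<^sup>2 * weight (V - {a, c}) E"
proof -
  have "weight V E \<le> 89/100 * weight (V - {a}) E"
    using assms by (intro weight_isolated) auto
  moreover have "weight (V - {a}) E \<le> 89/100 * weight (V - {a} - {c}) E"
    using assms by (intro weight_isolated) auto
  moreover have "V - {a} - {c} = V - {a, c}" by blast
  ultimately show ?thesis by (simp add: power2_eq_square)
qed

text \<open>A minimal hitting set contains exactly one vertex of such a triple, whence a factor 3 *
  21/50 * (89/100)^2 < 1 over the weight of the rest. Branching on the three vertices in turn
  realises the three choices.\<close>

lemma weight_disjoint_triple:
  assumes b: "bounded_below V" and r: "rank3 V E"
    and e: "e \<in> E" "card e = 3" and disj: "\<And>e'. e' \<in> E \<Longrightarrow> e' \<noteq> e \<Longrightarrow> e \<inter> e' = {}"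
  shows "weight V E \<le> 1"
proof -
  obtain a c d where abc: "e = {a, c, d}" "a \<noteq> c" "a \<noteq> d" "c \<noteq> d"
    using e(2) by (auto simp: card_3_iff)
  have V: "a \<in> V" "c \<in> V" "d \<in> V" "finite V" using rank3D[OF r] e abc by auto
  let ?E = "E - {e}"
  have notin: "a \<notin> e'" "c \<notin> e'" "d \<notin> e'" if "e' \<in> ?E" for e'
    using disj[of e'] that abc by auto
  have E: "E = insert {a, c, d} ?E" using e abc by auto
  \<comment> \<open>The other edges avoid the triple, so neither branch on one of its vertices
    changes them.\<close>
  have keep: "(\<lambda>e. e - {x}) ` ?E = ?E" "{e \<in> ?E. e \<inter> {x} = {}} = ?E" if "x \<in> {a, c, d}" for x
  proof -
    have "x \<notin> e'" if "e' \<in> ?E" for e' using notin[OF that] \<open>x \<in> {a, c, d}\<close> by blast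
    then have "(\<lambda>e. e - {x}) ` ?E = id ` ?E" "\<And>e'. e' \<in> ?E \<Longrightarrow> e' \<inter> {x} = {}"
      by (auto intro!: image_cong)
    then show "(\<lambda>e. e - {x}) ` ?E = ?E" "{e \<in> ?E. e \<inter> {x} = {}} = ?E" by auto
  qed
  let ?W = "weight (V - {a, c, d}) ?E"
  have W: "?W \<le> 1"
  proof -
    have "rank3 (V - {a, c, d}) {e' \<in> E. e' \<inter> {a, c, d} = {}}" using rank3_include[OF r] .
    moreover have "{e' \<in> E. e' \<inter> {a, c, d} = {}} = ?E" using disj abc by auto
    moreover have "card (V - {a, c, d}) < card V"
      using V by (intro psubset_card_mono) auto
    ultimately show ?thesis using b unfolding bounded_below_def by auto
  qed
  have a_in: "weight (V - {a}) {e \<in> E. e \<inter> {a} = {}} \<le> (89/100)\<^sup>2 * ?W"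
  proof -
    have "{e \<in> E. e \<inter> {a} = {}} = {e \<in> ?E. e \<inter> {a} = {}}" using abc(1) by auto
    then have "{e \<in> E. e \<inter> {a} = {}} = ?E" using keep(2)[of a] by simp
    moreover have "V - {a} - {c, d} = V - {a, c, d}" by blast
    ultimately show ?thesis using weight_isolated_pair[of "V - {a}" c d ?E] V abc notin by auto
  qed
  have Ea: "(\<lambda>e. e - {a}) ` E = insert {c, d} ?E"
  proof -
    have "(\<lambda>e. e - {a}) ` E = insert ({a, c, d} - {a}) ((\<lambda>e. e - {a}) ` ?E)"
      by (subst E) (rule image_insert)
    moreover have "{a, c, d} - {a} = {c, d}" using abc by blast
    ultimately show ?thesis using keep(1)[of a] by simp
  qed
  have Ec: "(\<lambda>e. e - {c}) ` insert {c, d} ?E = insert {d} ?E"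
    using keep(1)[of c] abc by (simp add: insert_Diff_if)
  have Ed: "(\<lambda>e. e - {d}) ` insert {d} ?E = insert {} ?E"
    using keep(1)[of d] by simp
  have c_in: "weight (V - {a} - {c}) {e \<in> insert {c, d} ?E. e \<inter> {c} = {}} \<le> 89/100 * ?W"
  proof -
    have "{e \<in> insert {c, d} ?E. e \<inter> {c} = {}} = ?E" using keep(2)[of c] by auto
    moreover have "V - {a} - {c} - {d} = V - {a, c, d}" by blast
    ultimately show ?thesis using weight_isolated[of "V - {a} - {c}" d ?E] V abc notin by auto
  qed
  have d_in: "weight (V - {a} - {c}) (insert {d} ?E) \<le> 21/50 * ?W"
  proof -
    have "{e \<in> insert {d} ?E. e \<inter> {d} = {}} = ?E" using keep(2)[of d] by auto
    moreover have "V - {a} - {c} - {d} = V - {a, c, d}" by blast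
    ultimately show ?thesis
      using weight_branch[of "V - {a} - {c}" d "insert {d} ?E"] V abc Ed
        weight_empty_edge[of "insert {} ?E" "V - {a, c, d}"] by auto
  qed
  have "weight (V - {a}) (insert {c, d} ?E) \<le> 21/50 * (89/100 * ?W) + 89/100 * (21/50 * ?W)"
    using weight_branch[of "V - {a}" c "insert {c, d} ?E"] V abc c_in d_in unfolding Ec by auto
  \<comment> \<open>The three summands belong to the choices of \<open>a\<close>, \<open>c\<close>
    and \<open>d\<close>; each equals 21/50 * (89/100)^2 * \<open>?W\<close>.\<close>
  then have "weight V E \<le> 21/50 * ((89/100)\<^sup>2 * ?W) + 89/100 * (21/50 * (89/100 * ?W) + 89/100 * (21/50 * ?W))"
    using weight_branch[OF V(4,1), of E] a_in unfolding Ea by argo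
  then show ?thesis using W weight_nonneg[of "V - {a, c, d}" ?E] by (simp add: power2_eq_square)
qed

text \<open>An edge with fewer than three vertices gives a bound below 1 at once. If all edges are
  triples, a chosen one either meets another or is disjoint from all others.\<close>

lemma weight_le_1: "rank3 V E \<Longrightarrow> weight V E \<le> 1"
proof (induction "card V" arbitrary: V E rule: less_induct)
  case less
  have b: "bounded_below V" using less.hyps unfolding bounded_below_def by blast
  note r = less.prems
  show ?case
  proof (cases "E = {}")
    case True
    then have "{S. minimal_hitting_set V E S} = {{}}"
      by (auto simp: minimal_hitting_set_iff_private hitting_set_def)
    then show ?thesis unfolding weight_def by (simp add: power_le_one)
  next
    case False
    then obtain e where e: "e \<in> E" by blast
    show ?thesis
    proof (cases "\<forall>e\<in>E. card e = 3")
      case True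
      then show ?thesis
        using weight_disjoint_triple[OF b r e] weight_meeting_triples[OF b r e] e by blast
    next
      case False
      then obtain e where e: "e \<in> E" "card e \<noteq> 3" by blast
      have "finite e" using rank3D[OF r] e finite_subset by blast
      moreover have "card e = 0 \<or> card e = 1 \<or> card e = 2" using rank3D(3)[OF r e(1)] e(2) by linarith
      ultimately consider "e = {}" | a where "e = {a}" | a c where "e = {a, c}" "a \<noteq> c"
        by (auto simp: card_1_singleton_iff card_2_iff)
      then show ?thesis
        using weight_empty_edge[of E V] weight_singleton[OF b r] weight_pair[OF b r] e(1)
        by cases force+
    qed
  qed
qed

section \<open>Averaging over random vertex deletions\<close>

text \<open>The binomial theorem over subsets: every element of \<open>A\<close> chooses
  \<open>x\<close> or \<open>y\<close>. It evaluates sums over the subsets of a fixed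
  \<open>S\<close> as well as the total probability over \<open>V\<close>.\<close>

lemma sum_Pow_powers:
  fixes x y :: real
  assumes "finite A"
  shows "(\<Sum>X\<in>Pow A. x ^ card X * y ^ card (A - X)) = (x + y) ^ card A"
  using assms
proof induction
  case (insert a A)
  have 1: "(\<Sum>X\<in>Pow A. x ^ card X * y ^ card (insert a A - X)) = y * (\<Sum>X\<in>Pow A. x ^ card X * y ^ card (A - X))"
    unfolding sum_distrib_left
  proof (rule sum.cong)
    fix X assume X: "X \<in> Pow A"
    then have "insert a A - X = insert a (A - X)" using insert.hyps by blast
    then show "x ^ card X * y ^ card (insert a A - X) = y * (x ^ card X * y ^ card (A - X))"
      using insert.hyps by simp
  qed simp
  have 2: "(\<Sum>X\<in>insert a ` Pow A. x ^ card X * y ^ card (insert a A - X))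
    = x * (\<Sum>X\<in>Pow A. x ^ card X * y ^ card (A - X))"
  proof -
    have "inj_on (insert a) (Pow A)"
      using insert.hyps by (intro inj_onI) (metis Pow_iff insert_ident subset_iff)
    then have "(\<Sum>X\<in>insert a ` Pow A. x ^ card X * y ^ card (insert a A - X))
      = (\<Sum>X\<in>Pow A. x ^ card (insert a X) * y ^ card (insert a A - insert a X))"
      by (simp add: sum.reindex)
    also have "\<dots> = (\<Sum>X\<in>Pow A. x * (x ^ card X * y ^ card (A - X)))"
    proof (rule sum.cong)
      fix X assume X: "X \<in> Pow A"
      then have "insert a A - insert a X = A - X" "a \<notin> X" "finite X"
        using insert.hyps finite_subset by blast+
      then show "x ^ card (insert a X) * y ^ card (insert a A - insert a X) = x * (x ^ card X * y ^ card (A - X))"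
        by simp
    qed simp
    finally show ?thesis by (simp add: sum_distrib_left)
  qed
  show ?case unfolding Pow_insert
    by (subst sum.union_disjoint) (use insert 1 2 in \<open>auto simp: algebra_simps\<close>)
qed simp

text \<open>
  A random \<open>X\<close> contains each vertex with probability \<open>47/147\<close>, which makes a vertex in \<open>S\<close>
  contribute \<open>47/147 + 100/147 * a\<close> and a vertex outside \<open>S\<close> contribute \<open>100/147 * b\<close>, both equal to \<open>89/147\<close>.
\<close>

theorem card_minimal_hitting_sets_le:
  assumes "rank3 V E"
  shows "real (card {S. minimal_hitting_set V E S}) \<le> (147/89) ^ card V"
proof -
  let ?M = "{S. minimal_hitting_set V E S}"
  let ?p = "\<lambda>X. (47/147 :: real) ^ card X * (100/147) ^ card (V - X)"
  let ?w = "\<lambda>X S. (21/50 :: real) ^ card (S - X) * (89/100) ^ card (V - S)"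
  have fV: "finite V" using rank3D(1)[OF assms] .
  have fM: "finite ?M" using finite_minimal_hitting_sets[OF fV] .
  have cell: "(\<Sum>X\<in>Pow S. ?p X * ?w X S) = (89/147) ^ card V" if "S \<in> ?M" for S
  proof -
    have S: "S \<subseteq> V" using that by (auto simp: minimal_hitting_set_def hitting_set_def)
    then have fS: "finite S" using fV finite_subset by blast
    have "(\<Sum>X\<in>Pow S. ?p X * ?w X S)
      = (\<Sum>X\<in>Pow S. (89/147) ^ card (V - S) * ((47/147) ^ card X * (42/147) ^ card (S - X)))"
    proof (rule sum.cong)
      fix X assume "X \<in> Pow S"
      \<comment> \<open>The factors 100/147 of \<open>V - X\<close> are distributed: a vertex of
        \<open>S - X\<close> gets 100/147 * 21/50 = 42/147, a vertex outside \<open>S\<close> gets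
        100/147 * 89/100 = 89/147.\<close>
      then have "V - X = (S - X) \<union> (V - S)" using S by blast
      then have "card (V - X) = card (S - X) + card (V - S)"
        using fV fS by (metis Diff_disjoint Int_Diff card_Un_disjoint finite_Diff inf_commute Int_empty_left)
      then have "?p X * ?w X S = (47/147) ^ card X * ((100/147) * (21/50)) ^ card (S - X) * ((100/147) * (89/100)) ^ card (V - S)"
        by (simp only: power_add power_mult_distrib mult.assoc mult.left_commute mult.commute)
      then show "?p X * ?w X S = (89/147) ^ card (V - S) * ((47/147) ^ card X * (42/147) ^ card (S - X))"
        by (simp add: mult_ac)
    qed simp
    also have "\<dots> = (89/147) ^ card (V - S) * (47/147 + 42/147) ^ card S"
      by (simp only: sum_distrib_left[symmetric] sum_Pow_powers[OF fS])
    also have "\<dots> = (89/147) ^ (card (V - S) + card S)"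
      by (simp add: power_add)
    also have "card (V - S) + card S = card V"
      using card_Diff_subset[OF fS S] card_mono[OF fV S] by simp
    finally show ?thesis .
  qed
  have "real (card ?M) * (89/147) ^ card V = (\<Sum>S\<in>?M. \<Sum>X\<in>Pow S. ?p X * ?w X S)"
    using cell by simp
  also have "\<dots> = (\<Sum>S\<in>?M. \<Sum>X | X \<in> Pow V \<and> X \<subseteq> S. ?p X * ?w X S)"
    by (intro sum.cong) (auto simp: minimal_hitting_set_def hitting_set_def)
  also have "\<dots> = (\<Sum>X\<in>Pow V. \<Sum>S | S \<in> ?M \<and> X \<subseteq> S. ?p X * ?w X S)"
    using sum.swap_restrict[OF fM finite_Pow_iff[THEN iffD2, OF fV]] by fast
  also have "\<dots> \<le> (\<Sum>X\<in>Pow V. ?p X)"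
  proof (rule sum_mono)
    fix X assume "X \<in> Pow V"
    let ?A = "{S. S \<in> ?M \<and> X \<subseteq> S}"
    \<comment> \<open>For fixed \<open>X\<close>, the map from \<open>S\<close> to
      \<open>S - X\<close> is injective into the minimal hitting sets of the hypergraph left after
      deleting \<open>X\<close>, whose weight is at most 1.\<close>
    have "(\<Sum>S\<in>?A. ?w X S) = (\<Sum>S\<in>(\<lambda>S. S - X) ` ?A. (21/50) ^ card S * (89/100) ^ card (V - X - S))"
    proof (subst sum.reindex)
      show "inj_on (\<lambda>S. S - X) ?A" unfolding inj_on_def by blast
      have "V - X - (S - X) = V - S" if "X \<subseteq> S" for S using that by blast
      then show "(\<Sum>S\<in>?A. ?w X S) = sum ((\<lambda>S. (21/50) ^ card S * (89/100) ^ card (V - X - S)) \<circ> (\<lambda>S. S - X)) ?A"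
        by (intro sum.cong) auto
    qed
    also have "\<dots> \<le> weight (V - X) {e \<in> E. e \<inter> X = {}}"
      unfolding weight_def
      by (rule sum_mono2) (use fV minimal_hitting_set_include in
          \<open>auto intro: finite_minimal_hitting_sets\<close>)
    also have "\<dots> \<le> 1" using weight_le_1[OF rank3_include[OF assms]] .
    finally show "(\<Sum>S\<in>?A. ?p X * ?w X S) \<le> ?p X"
      unfolding sum_distrib_left[symmetric] by (intro mult_left_le) auto
  qed
  also have "\<dots> = 1" by (subst sum_Pow_powers[OF fV]) simp
  finally have "real (card ?M) * (89/147) ^ card V * (147/89) ^ card V \<le> 1 * (147/89) ^ card V"
    by (intro mult_right_mono) auto
  then show ?thesis by (simp add: mult.assoc power_mult_distrib[symmetric])
qed

subsection \<open>A program for Berge multiplication\<close>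

text \<open>A bound instead of the exact step count lets all branches of a conditional share one
  estimate.\<close>

definition evaluates :: "program \<Rightarrow> sexp list \<Rightarrow> expr \<Rightarrow> sexp \<Rightarrow> nat \<Rightarrow> bool" where
  "evaluates P \<rho> e v B \<longleftrightarrow> (\<exists>t\<le>B. eval P \<rho> e v t)"

definition evaluates_args :: "program \<Rightarrow> sexp list \<Rightarrow> expr list \<Rightarrow> sexp list \<Rightarrow> nat \<Rightarrow> bool" where
  "evaluates_args P \<rho> es vs B \<longleftrightarrow> (\<exists>t\<le>B. eval_args P \<rho> es vs t)"

text \<open>The value is given up to an equation, so that an expression can be evaluated
  symbolically first, with one equation and one inequality left to check.\<close>

lemma evaluates_mono: "evaluates P \<rho> e v' B' \<Longrightarrow> v' = v \<Longrightarrow> B' \<le> B \<Longrightarrow> evaluates P \<rho> e v B"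
  unfolding evaluates_def by (meson le_trans)

text \<open>The largest environment has five entries: the four arguments of
  \<open>extend_body\<close> and its \<open>ELet\<close>.\<close>

lemma evaluates_Var:
  "evaluates P (v0 # \<rho>) (EVar 0) v0 1"
  "evaluates P (v0 # v1 # \<rho>) (EVar 1) v1 1"
  "evaluates P (v0 # v1 # v2 # \<rho>) (EVar 2) v2 1"
  "evaluates P (v0 # v1 # v2 # v3 # \<rho>) (EVar 3) v3 1"
  "evaluates P (v0 # v1 # v2 # v3 # v4 # \<rho>) (EVar 4) v4 1"
  unfolding evaluates_def
  using eval_Var[of 0 "v0 # \<rho>" P] eval_Var[of 1 "v0 # v1 # \<rho>" P] eval_Var[of 2 "v0 # v1 # v2 # \<rho>" P]
    eval_Var[of 3 "v0 # v1 # v2 # v3 # \<rho>" P] eval_Var[of 4 "v0 # v1 # v2 # v3 # v4 # \<rho>" P]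
  by (auto simp: numeral_eq_Suc)

lemma evaluates_Null: "evaluates P \<rho> ENull Null 1"
  unfolding evaluates_def by (blast intro: eval_Null)

lemma evaluates_Cons: "evaluates P \<rho> e1 v1 B1 \<Longrightarrow> evaluates P \<rho> e2 v2 B2 \<Longrightarrow>
    evaluates P \<rho> (ECons e1 e2) (Dot v1 v2) (B1 + B2 + 1)"
  unfolding evaluates_def by (meson eval_Cons add_mono order_refl)

lemma evaluates_Car: "evaluates P \<rho> e (Dot v w) B \<Longrightarrow> evaluates P \<rho> (ECar e) v (B + 1)"
  unfolding evaluates_def by (meson eval_Car add_mono order_refl)

lemma evaluates_Cdr: "evaluates P \<rho> e (Dot v w) B \<Longrightarrow> evaluates P \<rho> (ECdr e) w (B + 1)"
  unfolding evaluates_def by (meson eval_Cdr add_mono order_refl)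

lemma evaluates_Eq_Atom:
  assumes "evaluates P \<rho> e1 (Atom x) B1" "evaluates P \<rho> e2 (Atom y) B2"
  shows "evaluates P \<rho> (EEq e1 e2) (sexp_of_bool (x = y)) (B1 + B2 + 1)"
proof -
  obtain t1 t2 where t: "t1 \<le> B1" "t2 \<le> B2" "eval P \<rho> e1 (Atom x) t1" "eval P \<rho> e2 (Atom y) t2"
    using assms unfolding evaluates_def by blast
  have "eval P \<rho> (EEq e1 e2) (sexp_of_bool (x = y)) (t1 + t2 + 1)"
    using eval_Eq[OF t(3,4)] by simp
  then show ?thesis using t(1,2) unfolding evaluates_def by (meson add_mono order_refl)
qed

lemma evaluates_If:
  assumes "evaluates P \<rho> e0 v0 B0" "evaluates P \<rho> (if v0 = Null then e2 else e1) v B"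
  shows "evaluates P \<rho> (EIf e0 e1 e2) v (B0 + B + 1)"
proof -
  obtain t0 t where t: "t0 \<le> B0" "t \<le> B" "eval P \<rho> e0 v0 t0"
    "eval P \<rho> (if v0 = Null then e2 else e1) v t"
    using assms unfolding evaluates_def by blast
  then have "eval P \<rho> (EIf e0 e1 e2) v (t0 + t + 1)"
    by (cases "v0 = Null") (use eval_If_true eval_If_false in \<open>simp_all only: if_True if_False simp_thms\<close>)
  then show ?thesis using t(1,2) unfolding evaluates_def by (meson add_mono order_refl)
qed

lemma evaluates_Let: "evaluates P \<rho> e1 v1 B1 \<Longrightarrow> evaluates P (v1 # \<rho>) e2 v B2 \<Longrightarrow>
    evaluates P \<rho> (ELet e1 e2) v (B1 + B2 + 1)"
  unfolding evaluates_def by (meson eval_Let add_mono order_refl)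

lemma evaluates_Call: "evaluates_args P \<rho> es vs B1 \<Longrightarrow> f < length P \<Longrightarrow> evaluates P vs (P ! f) v B2 \<Longrightarrow>
    evaluates P \<rho> (ECall f es) v (B1 + B2 + 1)"
  unfolding evaluates_def evaluates_args_def by (meson eval_Call add_mono order_refl)

lemma evaluates_args_Nil: "evaluates_args P \<rho> [] [] 0"
  unfolding evaluates_args_def by (blast intro: eval_args_Nil)

lemma evaluates_args_Cons: "evaluates P \<rho> e v B1 \<Longrightarrow> evaluates_args P \<rho> es vs B2 \<Longrightarrow>
    evaluates_args P \<rho> (e # es) (v # vs) (B1 + B2)"
  unfolding evaluates_def evaluates_args_def by (meson eval_args_Cons add_mono)

lemmas evaluates_intros = evaluates_Var evaluates_Null evaluates_Cons evaluates_Car evaluates_Cdr evaluates_Eq_Atom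
  evaluates_If evaluates_Let evaluates_args_Nil evaluates_args_Cons

lemma sexp_of_bool_simps: "sexp_of_bool False = Null" "sexp_of_bool True = Dot Null Null"
  "sexp_of_bool b = Null \<longleftrightarrow> \<not> b"
  unfolding sexp_of_bool_def by auto

lemma sexp_of_vertices_simps: "sexp_of_vertices [] = Null"
  "sexp_of_vertices (x # xs) = Dot (Atom x) (sexp_of_vertices xs)"
  unfolding sexp_of_vertices_def by auto

lemma sexp_of_family_simps: "sexp_of_family [] = Null"
  "sexp_of_family (xs # xss) = Dot (sexp_of_vertices xs) (sexp_of_family xss)"
  unfolding sexp_of_family_def by auto

lemmas sexp_simps = sexp_of_bool_simps sexp_of_vertices_simps sexp_of_family_simps

lemmas branch_simps = if_True if_False sexp_simps sexp.distinct simp_thms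

section \<open>The program\<close>

abbreviation (input) ETrue :: expr where "ETrue \<equiv> ECons ENull ENull"

text \<open>The numbers in calls are positions in \<open>berge_program\<close> below.\<close>

definition member_body :: expr where
  "member_body = EIf (EVar 1)
     (EIf (EEq (EVar 0) (ECar (EVar 1))) ETrue (ECall 8 [EVar 0, ECdr (EVar 1)])) ENull"

definition meets_body :: expr where
  "meets_body = EIf (EVar 0)
     (EIf (ECall 8 [ECar (EVar 0), EVar 1]) ETrue (ECall 7 [ECdr (EVar 0), EVar 1])) ENull"

definition remove_body :: expr where
  "remove_body = EIf (EVar 1)
     (EIf (EEq (EVar 0) (ECar (EVar 1))) (ECall 6 [EVar 0, ECdr (EVar 1)])
       (ECons (ECar (EVar 1)) (ECall 6 [EVar 0, ECdr (EVar 1)]))) ENull"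

definition hits_body :: expr where
  "hits_body = EIf (EVar 1)
     (EIf (ECall 7 [ECar (EVar 1), EVar 0]) (ECall 5 [EVar 0, ECdr (EVar 1)]) ENull) ETrue"

text \<open>Arguments: the vertices still to be tested, the candidate set, the processed
  edges.\<close>

definition minimal_body :: expr where
  "minimal_body = EIf (EVar 0)
     (EIf (ECall 5 [ECall 6 [ECar (EVar 0), EVar 1], EVar 2]) ENull
       (ECall 4 [ECdr (EVar 0), EVar 1, EVar 2])) ETrue"

text \<open>Arguments: the remaining vertices of the new edge, the set to extend, the processed
  edges, and the list in front of which results are put. Under \<open>ELet\<close> these shift by
  one and \<open>EVar 0\<close> is the candidate.\<close>

definition extend_body :: expr where
  "extend_body = EIf (EVar 0)
     (ELet (ECons (ECar (EVar 0)) (EVar 1))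
       (EIf (ECall 4 [EVar 0, EVar 0, EVar 3])
         (ECons (EVar 0) (ECall 3 [ECdr (EVar 1), EVar 2, EVar 3, EVar 4]))
         (ECall 3 [ECdr (EVar 1), EVar 2, EVar 3, EVar 4])))
     (EVar 3)"

definition step_body :: expr where
  "step_body = EIf (EVar 0)
     (EIf (ECall 7 [EVar 1, ECar (EVar 0)])
       (ECons (ECar (EVar 0)) (ECall 2 [ECdr (EVar 0), EVar 1, EVar 2]))
       (ECall 3 [EVar 1, ECar (EVar 0), EVar 2, ECall 2 [ECdr (EVar 0), EVar 1, EVar 2]]))
     ENull"

text \<open>Arguments: the remaining edges, the processed edges, the current family.\<close>

definition loop_body :: expr where
  "loop_body = EIf (EVar 0)
     (ECall 1 [ECdr (EVar 0), ECons (ECar (EVar 0)) (EVar 1),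
       ECall 2 [EVar 2, ECar (EVar 0), ECons (ECar (EVar 0)) (EVar 1)]])
     (EVar 2)"

text \<open>The loop starts with no processed edges and the family consisting of the empty set,
  which \<open>ECons ENull ENull\<close> encodes.\<close>

definition berge_program :: program where
  "berge_program = [ECall 1 [ECdr (EVar 0), ENull, ECons ENull ENull], loop_body, step_body, extend_body,
     minimal_body, hits_body, remove_body, meets_body, member_body]"

lemma berge_program_nth:
  "berge_program ! 0 = ECall 1 [ECdr (EVar 0), ENull, ECons ENull ENull]"
  "berge_program ! 1 = loop_body" "berge_program ! 2 = step_body" "berge_program ! 3 = extend_body"
  "berge_program ! 4 = minimal_body" "berge_program ! 5 = hits_body" "berge_program ! 6 = remove_body"
  "berge_program ! 7 = meets_body" "berge_program ! 8 = member_body" "length berge_program = 9"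
  by (simp_all add: berge_program_def)

lemma evaluates_berge_Call:
  "evaluates_args berge_program \<rho> es vs B1 \<Longrightarrow> f < 9 \<Longrightarrow> evaluates berge_program vs (berge_program ! f) v B2 \<Longrightarrow>
    evaluates berge_program \<rho> (ECall f es) v (B1 + B2 + 1)"
  by (rule evaluates_Call) (auto simp: berge_program_nth)

section \<open>Running times of the list operations\<close>

lemma evaluates_member:
  "evaluates berge_program [Atom x, sexp_of_vertices C] member_body (sexp_of_bool (x \<in> set C))
    (11 * (length C + 1))"
proof (induction C)
  case Nil
  show ?case unfolding member_body_def sexp_simps
    by (rule evaluates_mono, (rule evaluates_intros | simp only: branch_simps)+)
      (simp_all add: sexp_simps)
next
  case (Cons y C)
  note call = evaluates_berge_Call[where f = 8, unfolded berge_program_nth, OF _ _ Cons.IH]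
  show ?case unfolding member_body_def sexp_simps
    by (cases "x = y";
        rule evaluates_mono, (rule evaluates_intros call | simp only: branch_simps)+,
        simp_all add: sexp_simps)
qed

text \<open>Per vertex of \<open>e\<close>, the membership scan takes 11 * (\<open>length C\<close>
  + 1) steps and the code around it at most 11 more, hence the factor 22.\<close>

lemma evaluates_meets:
  "evaluates berge_program [sexp_of_vertices e, sexp_of_vertices C] meets_body
    (sexp_of_bool (set e \<inter> set C \<noteq> {})) (22 * (length e + 1) * (length C + 1))"
proof (induction e)
  case Nil
  show ?case unfolding meets_body_def sexp_simps
    by (rule evaluates_mono, (rule evaluates_intros | simp only: branch_simps)+)
      (simp_all add: sexp_simps)
next
  case (Cons y e)
  note call = evaluates_berge_Call[where f = 7, unfolded berge_program_nth, OF _ _ Cons.IH]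
    evaluates_berge_Call[where f = 8, unfolded berge_program_nth, OF _ _ evaluates_member]
  show ?case unfolding meets_body_def sexp_simps
    by (cases "y \<in> set C";
        rule evaluates_mono, (rule evaluates_intros call | simp only: branch_simps)+,
        simp_all add: sexp_simps algebra_simps)
qed

lemma evaluates_remove:
  "evaluates berge_program [Atom x, sexp_of_vertices C] remove_body (sexp_of_vertices (removeAll x C))
    (15 * (length C + 1))"
proof (induction C)
  case Nil
  show ?case unfolding remove_body_def sexp_simps
    by (rule evaluates_mono, (rule evaluates_intros | simp only: branch_simps)+)
      (simp_all add: sexp_simps)
next
  case (Cons y C)
  note call = evaluates_berge_Call[where f = 6, unfolded berge_program_nth, OF _ _ Cons.IH]
  show ?case unfolding remove_body_def sexp_simps
    by (cases "x = y";
        rule evaluates_mono, (rule evaluates_intros call | simp only: branch_simps)+,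
        simp_all add: sexp_simps)
qed

section \<open>Berge multiplication on lists and its cost\<close>

text \<open>In this and the following cost functions, \<open>N\<close> bounds the lengths of vertex
  lists, \<open>M\<close> the number of edges and \<open>R\<close> the size of the family. Each is a
  cost per entry of the list that the function recurses on.\<close>

definition hits_cost :: "nat \<Rightarrow> nat" where
  "hits_cost N = 22 * (N + 1) * (N + 1) + 12"

definition minimal_cost :: "nat \<Rightarrow> nat \<Rightarrow> nat" where
  "minimal_cost N M = 15 * (N + 1) + hits_cost N * (M + 1) + 20"

definition extend_cost :: "nat \<Rightarrow> nat \<Rightarrow> nat" where
  "extend_cost N M = minimal_cost N M * (N + 1) + 30"

definition step_cost :: "nat \<Rightarrow> nat \<Rightarrow> nat" where
  "step_cost N M = extend_cost N M * (N + 1) + 22 * (N + 1) * (N + 1) + 30"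

definition loop_cost :: "nat \<Rightarrow> nat \<Rightarrow> nat \<Rightarrow> nat" where
  "loop_cost N M R = step_cost N M * (R + 1) + 30"

definition hits :: "'a list \<Rightarrow> 'a list list \<Rightarrow> bool" where
  "hits S D \<longleftrightarrow> (\<forall>e\<in>set D. set e \<inter> set S \<noteq> {})"

definition irredundant :: "'a list list \<Rightarrow> 'a list \<Rightarrow> bool" where
  "irredundant D S \<longleftrightarrow> (\<forall>u\<in>set S. \<not> hits (removeAll u S) D)"

definition extensions :: "'a list list \<Rightarrow> 'a list \<Rightarrow> 'a list \<Rightarrow> 'a list list" where
  "extensions D e T = filter (irredundant D) (map (\<lambda>v. v # T) e)"

text \<open>\<open>D\<close> is meant to contain \<open>e\<close> already, so irredundance is tested
  against the enlarged edge list. A set meeting \<open>e\<close> is kept untested because its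
  private edges persist.\<close>

definition berge_step :: "'a list list \<Rightarrow> 'a list \<Rightarrow> 'a list list \<Rightarrow> 'a list list" where
  "berge_step D e Ts =
     concat (map (\<lambda>T. if set e \<inter> set T \<noteq> {} then [T] else extensions D e T) Ts)"

fun berge :: "'a list list \<Rightarrow> 'a list list \<Rightarrow> 'a list list \<Rightarrow> 'a list list" where
  "berge D [] Ts = Ts"
| "berge D (e # es) Ts = berge (e # D) es (berge_step (e # D) e Ts)"

lemma evaluates_meets_le:
  assumes "length e \<le> N" "length C \<le> N"
  shows "evaluates berge_program [sexp_of_vertices e, sexp_of_vertices C] meets_body
    (sexp_of_bool (set e \<inter> set C \<noteq> {})) (22 * (N + 1) * (N + 1))"
  by (rule evaluates_mono[OF evaluates_meets refl], intro mult_le_mono) (use assms in simp_all)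

lemma evaluates_hits:
  assumes "length S \<le> N" "\<forall>e\<in>set D. length e \<le> N"
  shows "evaluates berge_program [sexp_of_vertices S, sexp_of_family D] hits_body
    (sexp_of_bool (hits S D)) (hits_cost N * (length D + 1))"
  using assms(2)
proof (induction D)
  case Nil
  show ?case unfolding hits_body_def sexp_simps
    by (rule evaluates_mono, (rule evaluates_intros | simp only: branch_simps)+)
      (simp_all add: sexp_simps hits_def hits_cost_def)
next
  case (Cons e D)
  have "length e \<le> N" and IH: "evaluates berge_program [sexp_of_vertices S, sexp_of_family D] hits_body
    (sexp_of_bool (hits S D)) (hits_cost N * (length D + 1))"
    using Cons by auto
  note call = evaluates_berge_Call[where f = 5, unfolded berge_program_nth, OF _ _ IH]
    evaluates_berge_Call[where f = 7, unfolded berge_program_nth, OF _ _ evaluates_meets_le[OF \<open>length e \<le> N\<close> assms(1)]]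
  show ?case unfolding hits_body_def sexp_simps
    by (cases "set e \<inter> set S = {}";
        rule evaluates_mono, (rule evaluates_intros call | simp only: branch_simps)+,
        simp_all add: sexp_simps hits_def hits_cost_def)
qed

text \<open>The recursion consumes \<open>U\<close> while the candidate \<open>S\<close> stays
  intact; for \<open>U = S\<close> this is the irredundance test.\<close>

lemma evaluates_minimal:
  assumes "length S \<le> N" "\<forall>e\<in>set D. length e \<le> N" "length D \<le> M"
  shows "evaluates berge_program [sexp_of_vertices U, sexp_of_vertices S, sexp_of_family D] minimal_body
    (sexp_of_bool (\<forall>u\<in>set U. \<not> hits (removeAll u S) D)) (minimal_cost N M * (length U + 1))"
proof (induction U)
  case Nil
  show ?case unfolding minimal_body_def sexp_simps
    by (rule evaluates_mono, (rule evaluates_intros | simp only: branch_simps)+)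
      (simp_all add: sexp_simps minimal_cost_def)
next
  case (Cons u U)
  have "length (removeAll u S) \<le> N" using assms(1) length_filter_le[of _ S] le_trans
    unfolding removeAll_filter_not_eq by blast
  moreover have "hits_cost N * (length D + 1) \<le> hits_cost N * (M + 1)" "15 * (length S + 1) \<le> 15 * (N + 1)"
    using assms(1,3) by (simp_all only: mult_le_mono add_le_mono order_refl)
  ultimately have hits: "evaluates berge_program [sexp_of_vertices (removeAll u S), sexp_of_family D] hits_body
      (sexp_of_bool (hits (removeAll u S) D)) (hits_cost N * (M + 1))"
    and remove: "evaluates berge_program [Atom u, sexp_of_vertices S] remove_body (sexp_of_vertices (removeAll u S))
      (15 * (N + 1))"
    using evaluates_mono[OF evaluates_hits[OF _ assms(2)] refl] evaluates_mono[OF evaluates_remove refl] by blast+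
  note call = evaluates_berge_Call[where f = 4, unfolded berge_program_nth, OF _ _ Cons.IH]
    evaluates_berge_Call[where f = 5, unfolded berge_program_nth, OF _ _ hits]
    evaluates_berge_Call[where f = 6, unfolded berge_program_nth, OF _ _ remove]
  show ?case unfolding minimal_body_def sexp_simps
    by (cases "hits (removeAll u S) D";
        rule evaluates_mono, (rule evaluates_intros call | simp only: branch_simps)+,
        use assms in \<open>simp_all add: sexp_simps minimal_cost_def\<close>)
qed

lemma evaluates_extend:
  assumes "length T + 1 \<le> N" "\<forall>e\<in>set D. length e \<le> N" "length D \<le> M"
  shows "evaluates berge_program [sexp_of_vertices e, sexp_of_vertices T, sexp_of_family D, sexp_of_family A]
    extend_body (sexp_of_family (extensions D e T @ A)) (extend_cost N M * (length e + 1))"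
proof (induction e)
  case Nil
  show ?case unfolding extend_body_def sexp_simps
    by (rule evaluates_mono, (rule evaluates_intros | simp only: branch_simps)+)
      (simp_all add: sexp_simps extensions_def extend_cost_def)
next
  case (Cons v e)
  have "length (v # T) \<le> N" using assms(1) by simp
  moreover have "minimal_cost N M * (length (v # T) + 1) \<le> minimal_cost N M * (N + 1)"
    using assms(1) by (intro mult_le_mono) simp_all
  ultimately have minimal: "evaluates berge_program
      [Dot (Atom v) (sexp_of_vertices T), Dot (Atom v) (sexp_of_vertices T), sexp_of_family D] minimal_body
      (sexp_of_bool (irredundant D (v # T))) (minimal_cost N M * (N + 1))"
    using evaluates_mono[OF evaluates_minimal[OF _ assms(2,3)] refl]
    unfolding irredundant_def sexp_of_vertices_simps[symmetric] by blast
  note call = evaluates_berge_Call[where f = 3, unfolded berge_program_nth, OF _ _ Cons.IH]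
    evaluates_berge_Call[where f = 4, unfolded berge_program_nth, OF _ _ minimal]
  show ?case unfolding extend_body_def sexp_simps
    by (cases "irredundant D (v # T)";
        rule evaluates_mono, (rule evaluates_intros call | simp only: branch_simps)+,
        use assms in \<open>simp_all only: sexp_simps extensions_def extend_cost_def list.map filter.simps if_True if_False append.simps\<close>,
        use assms in \<open>simp_all add: algebra_simps\<close>)
qed

lemma evaluates_step:
  assumes "\<forall>T\<in>set Ts. length T + 1 \<le> N" "\<forall>e\<in>set D. length e \<le> N" "length D \<le> M" "length e \<le> N"
  shows "evaluates berge_program [sexp_of_family Ts, sexp_of_vertices e, sexp_of_family D] step_body
    (sexp_of_family (berge_step D e Ts)) (step_cost N M * (length Ts + 1))"
  using assms(1)
proof (induction Ts)
  case Nil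
  show ?case unfolding step_body_def sexp_simps
    by (rule evaluates_mono, (rule evaluates_intros | simp only: branch_simps)+)
      (simp_all add: sexp_simps berge_step_def step_cost_def)
next
  case (Cons T Ts)
  have T: "length T + 1 \<le> N" "length T \<le> N"
    and IH: "evaluates berge_program [sexp_of_family Ts, sexp_of_vertices e, sexp_of_family D] step_body
    (sexp_of_family (berge_step D e Ts)) (step_cost N M * (length Ts + 1))"
    using Cons by auto
  have "extend_cost N M * (length e + 1) \<le> extend_cost N M * (N + 1)"
    using assms(4) by (intro mult_le_mono) simp_all
  note extend = evaluates_mono[OF evaluates_extend[OF T(1) assms(2,3), of e] refl this]
  note call = evaluates_berge_Call[where f = 2, unfolded berge_program_nth, OF _ _ IH]
    evaluates_berge_Call[where f = 3, unfolded berge_program_nth, OF _ _ extend]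
    evaluates_berge_Call[where f = 7, unfolded berge_program_nth, OF _ _ evaluates_meets_le[OF assms(4) T(2)]]
  show ?case unfolding step_body_def sexp_simps
    by (cases "set e \<inter> set T = {}";
        rule evaluates_mono, (rule evaluates_intros call | simp only: branch_simps)+,
        use assms in \<open>simp_all add: sexp_simps berge_step_def step_cost_def\<close>)
qed

text \<open>The bounds are required for every prefix \<open>es1\<close>, since an intermediate
  family may be larger than the final one. The 1 added to \<open>length T\<close> leaves room for an
  extending vertex.\<close>

lemma evaluates_loop:
  assumes "\<And>es1 es2. es = es1 @ es2 \<Longrightarrow> length (berge D es1 Ts) \<le> R"
    and "\<And>es1 es2 T. es = es1 @ es2 \<Longrightarrow> T \<in> set (berge D es1 Ts) \<Longrightarrow> length T + 1 \<le> N"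
    and "\<forall>e\<in>set D \<union> set es. length e \<le> N" "length D + length es \<le> M"
  shows "evaluates berge_program [sexp_of_family es, sexp_of_family D, sexp_of_family Ts] loop_body
    (sexp_of_family (berge D es Ts)) (loop_cost N M R * (length es + 1))"
  using assms
proof (induction es arbitrary: D Ts)
  case Nil
  show ?case unfolding loop_body_def sexp_simps
    by (rule evaluates_mono, (rule evaluates_intros | simp only: branch_simps)+)
      (simp_all add: sexp_simps loop_cost_def)
next
  case (Cons e es)
  let ?Ts = "berge_step (e # D) e Ts"
  have IH: "evaluates berge_program [sexp_of_family es, sexp_of_family (e # D), sexp_of_family ?Ts] loop_body
    (sexp_of_family (berge (e # D) es ?Ts)) (loop_cost N M R * (length es + 1))"
  proof (rule Cons.IH)
    fix es1 es2 assume "es = es1 @ es2"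
    then have "e # es = (e # es1) @ es2" by simp
    from Cons.prems(1)[OF this] Cons.prems(2)[OF this]
    show "length (berge (e # D) es1 ?Ts) \<le> R"
      "\<And>T. T \<in> set (berge (e # D) es1 ?Ts) \<Longrightarrow> length T + 1 \<le> N" by simp_all
  qed (use Cons.prems(3,4) in auto)
  \<comment> \<open>The empty prefix yields the bounds on the current family.\<close>
  have "length Ts \<le> R" "\<forall>T\<in>set Ts. length T + 1 \<le> N"
    using Cons.prems(1)[of "[]"] Cons.prems(2)[of "[]"] by simp_all
  then have step: "evaluates berge_program [sexp_of_family Ts, sexp_of_vertices e, sexp_of_family (e # D)] step_body
    (sexp_of_family ?Ts) (step_cost N M * (R + 1))"
    by (intro evaluates_mono[OF evaluates_step[where N = N and M = M] refl] mult_le_mono)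
      (use Cons.prems(3,4) in auto)
  note call = evaluates_berge_Call[where f = 1, unfolded berge_program_nth, OF _ _ IH]
    evaluates_berge_Call[where f = 2, unfolded berge_program_nth, OF _ _ step]
  show ?case unfolding loop_body_def sexp_simps
    by (rule evaluates_mono, (rule evaluates_intros call[unfolded sexp_simps] |
          simp only: branch_simps)+)
      (simp_all add: loop_cost_def)
qed

text \<open>The entry call takes 2 steps, building the three arguments of the loop 6 and calling it
  1.\<close>

lemma evaluates_imp_runs:
  assumes "evaluates berge_program [sexp_of_family es, Null, Dot Null Null] loop_body v B"
  shows "\<exists>t. runs berge_program (sexp_of_hypergraph vs es) v t \<and> t \<le> B + 9"
proof -
  note call = evaluates_berge_Call[where f = 1, unfolded berge_program_nth, OF _ _ assms]
    evaluates_berge_Call[where f = 0]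
  have "evaluates berge_program [sexp_of_hypergraph vs es] (ECall 0 [EVar 0]) v (B + 9)"
    unfolding sexp_of_hypergraph_def
    by (rule evaluates_mono, (rule evaluates_intros call | simp only: berge_program_nth)+)
  then show ?thesis unfolding runs_def evaluates_def by blast
qed

subsection \<open>Correctness and running time\<close>

text \<open>This justifies the test made by the program: for a hitting set, an edge is private to
  \<open>u\<close> exactly when the set without \<open>u\<close> misses it.\<close>

lemma minimal_hitting_set_iff_irredundant:
  "minimal_hitting_set V (set ` set D) (set S) \<longleftrightarrow> hitting_set V (set ` set D) (set S) \<and> irredundant D S"
proof -
  have "(\<exists>e\<in>set ` set D. set S \<inter> e = {u}) \<longleftrightarrow> \<not> hits (removeAll u S) D"
    if "hitting_set V (set ` set D) (set S)" "u \<in> set S" for u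
  proof
    assume "\<exists>e\<in>set ` set D. set S \<inter> e = {u}"
    then obtain e where "e \<in> set D" "set S \<inter> set e = {u}" by blast
    then have "set e \<inter> set (removeAll u S) = {}" by auto
    then show "\<not> hits (removeAll u S) D" using \<open>e \<in> set D\<close> unfolding hits_def by blast
  next
    assume "\<not> hits (removeAll u S) D"
    then obtain e where "e \<in> set D" "set e \<inter> (set S - {u}) = {}" unfolding hits_def by auto
    moreover have "set S \<inter> set e \<noteq> {}" using that(1) \<open>e \<in> set D\<close> unfolding hitting_set_def by blast
    ultimately have "set S \<inter> set e = {u}" by auto
    then show "\<exists>e\<in>set ` set D. set S \<inter> e = {u}" using \<open>e \<in> set D\<close> by blast
  qed
  then show ?thesis unfolding minimal_hitting_set_iff_private irredundant_def by blast
qed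

text \<open>If \<open>S\<close> is not minimal for the old edges, some \<open>u\<close> has no
  private edge among them, so \<open>e\<close> is private to \<open>u\<close>. Then
  \<open>S - {u}\<close> still hits all old edges and is the set that was extended by
  \<open>u\<close>.\<close>

lemma minimal_hitting_set_insert_edge_cases:
  assumes "minimal_hitting_set V (insert e E) S"
  obtains "minimal_hitting_set V E S" "e \<inter> S \<noteq> {}"
  | T v where "minimal_hitting_set V E T" "e \<inter> T = {}" "v \<in> e" "S = insert v T"
proof (cases "minimal_hitting_set V E S")
  case True
  then show thesis using that(1) assms unfolding minimal_hitting_set_def hitting_set_def by blast
next
  case False
  have S: "S \<subseteq> V" "\<And>f. f \<in> E \<Longrightarrow> S \<inter> f \<noteq> {}"
    and priv: "\<And>u. u \<in> S \<Longrightarrow> \<exists>f\<in>insert e E. S \<inter> f = {u}"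
    using assms unfolding minimal_hitting_set_iff_private hitting_set_def by auto
  have "hitting_set V E S" using S unfolding hitting_set_def by simp
  then have "\<not> (\<forall>u\<in>S. \<exists>f\<in>E. S \<inter> f = {u})"
    using False unfolding minimal_hitting_set_iff_private by simp
  then obtain u where u: "u \<in> S" "\<And>f. f \<in> E \<Longrightarrow> S \<inter> f \<noteq> {u}" by blast
  then have e: "S \<inter> e = {u}" using priv[OF u(1)] by blast
  have "(S - {u}) \<inter> f \<noteq> {}" if "f \<in> E" for f using S(2)[OF that] u(2)[OF that] by auto
  moreover have "\<exists>f\<in>E. (S - {u}) \<inter> f = {w}" if w: "w \<in> S - {u}" for w
  proof -
    obtain f where f: "f \<in> insert e E" "S \<inter> f = {w}" using priv[of w] w by blast
    \<comment> \<open>The new edge is private to \<open>u\<close>, so the private edge of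
      \<open>w\<close> is an old one.\<close>
    then have "f \<in> E" using e w by auto
    moreover have "(S - {u}) \<inter> f = {w}" using f(2) w by auto
    ultimately show ?thesis by blast
  qed
  ultimately have "minimal_hitting_set V E (S - {u})"
    using S(1) unfolding minimal_hitting_set_iff_private hitting_set_def by auto
  moreover have "e \<inter> (S - {u}) = {}" "u \<in> e" "S = insert u (S - {u})" using e u(1) by auto
  ultimately show thesis using that(2) by blast
qed

lemma set_berge_step:
  "S \<in> set (berge_step D e Ts) \<longleftrightarrow> (\<exists>T\<in>set Ts. if set e \<inter> set T \<noteq> {} then S = T
     else irredundant D S \<and> (\<exists>v\<in>set e. S = v # T))"
  unfolding berge_step_def extensions_def by (auto split: if_splits)

lemma minimal_hitting_set_insert_edge:
  assumes "minimal_hitting_set V E S" "e \<inter> S \<noteq> {}"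
  shows "minimal_hitting_set V (insert e E) S"
proof -
  have "hitting_set V (insert e E) S"
    using assms unfolding minimal_hitting_set_def hitting_set_def by (simp add: Int_commute)
  then show ?thesis using assms(1) unfolding minimal_hitting_set_iff_private by blast
qed

lemma berge_step_sound:
  assumes "\<forall>T\<in>set Ts. minimal_hitting_set V (set ` set D) (set T)" "set e \<subseteq> V"
    and "S \<in> set (berge_step (e # D) e Ts)"
  shows "minimal_hitting_set V (set ` set (e # D)) (set S)"
proof -
  obtain T where T: "T \<in> set Ts" "if set e \<inter> set T \<noteq> {} then S = T
     else irredundant (e # D) S \<and> (\<exists>v\<in>set e. S = v # T)"
    using assms(3) unfolding set_berge_step by blast
  have m: "minimal_hitting_set V (set ` set D) (set T)" using assms(1) T(1) by blast
  show ?thesis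
  proof (cases "set e \<inter> set T \<noteq> {}")
    case True
    then show ?thesis using minimal_hitting_set_insert_edge[OF m, of "set e"] T(2) by simp
  next
    case False
    then obtain v where v: "irredundant (e # D) S" "v \<in> set e" "S = v # T" using T(2) by auto
    have "hitting_set V (set ` set (e # D)) (set S)"
      using m v(2,3) assms(2) unfolding minimal_hitting_set_def hitting_set_def by auto
    then show ?thesis using v(1) unfolding minimal_hitting_set_iff_irredundant by blast
  qed
qed

lemma berge_step_complete:
  assumes "{S. minimal_hitting_set V (set ` set D) S} \<subseteq> set ` set Ts"
    and "minimal_hitting_set V (set ` set (e # D)) S"
  shows "S \<in> set ` set (berge_step (e # D) e Ts)"
proof -
  have "minimal_hitting_set V (insert (set e) (set ` set D)) S" using assms(2) by simp
  then show ?thesis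
  proof (cases rule: minimal_hitting_set_insert_edge_cases)
    case 1
    then obtain T where "T \<in> set Ts" "S = set T" using assms(1) by blast
    then show ?thesis using 1(2) by (intro image_eqI[of _ _ T]) (auto simp: set_berge_step)
  next
    case (2 T v)
    then obtain T' where T': "T' \<in> set Ts" "T = set T'" using assms(1) by blast
    have "irredundant (e # D) (v # T')"
      using assms(2) 2(4) T'(2) minimal_hitting_set_iff_irredundant[of V "e # D" "v # T'"] by simp
    then have "v # T' \<in> set (berge_step (e # D) e Ts)"
      unfolding set_berge_step using T' 2(2,3) by (intro bexI[of _ T']) auto
    then show ?thesis using 2(4) T'(2) by (intro image_eqI[of _ _ "v # T'"]) auto
  qed
qed

text \<open>A set in the output determines its origin: it is its own origin if it is minimal for the
  old edges, and otherwise its origin arises by removing \<open>e\<close>.\<close>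

lemma distinct_berge_step:
  assumes "\<forall>T\<in>set Ts. minimal_hitting_set V (set ` set D) (set T)" "distinct (map set Ts)" "distinct e"
  shows "distinct (map set (berge_step D' e Ts))"
  using assms(1,2)
proof (induction Ts)
  case Nil
  show ?case by (simp add: berge_step_def)
next
  case (Cons T Ts)
  let ?origin = "\<lambda>A. if minimal_hitting_set V (set ` set D) A then A else A - set e"
  have origin: "\<exists>T\<in>set Ts'. ?origin (set S) = set T"
    if min: "\<forall>T\<in>set Ts'. minimal_hitting_set V (set ` set D) (set T)" and S: "S \<in> set (berge_step D' e Ts')" for S Ts'
  proof -
    obtain T where T: "T \<in> set Ts'" "if set e \<inter> set T \<noteq> {} then S = T
       else irredundant D' S \<and> (\<exists>v\<in>set e. S = v # T)"
      using S unfolding set_berge_step by blast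
    have m: "minimal_hitting_set V (set ` set D) (set T)" using min T(1) by blast
    show ?thesis
    proof (cases "set e \<inter> set T \<noteq> {}")
      case True
      then show ?thesis using T m by auto
    next
      case False
      then obtain v where v: "v \<in> set e" "S = v # T" using T(2) by auto
      \<comment> \<open>The extended set properly contains the old hitting set \<open>set T\<close>,
        so it is not minimal for the old edges and its origin is computed by removing
        \<open>e\<close>.\<close>
      then have "set T \<subset> set S" "set S - set e = set T" using False by auto
      then have "\<not> minimal_hitting_set V (set ` set D) (set S)"
        using m unfolding minimal_hitting_set_def by blast
      then show ?thesis using \<open>set S - set e = set T\<close> T(1) by auto
    qed
  qed
  have step: "berge_step D' e (T # Ts) = berge_step D' e [T] @ berge_step D' e Ts"
    by (simp add: berge_step_def)
  have "distinct (map set (berge_step D' e [T]))"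
  proof (cases "set e \<inter> set T = {}")
    case True
    have "inj_on (\<lambda>v. insert v (set T)) (set e)"
    proof (rule inj_onI)
      fix v w assume "v \<in> set e" "w \<in> set e" "insert v (set T) = insert w (set T)"
      then show "v = w" using True by blast
    qed
    then have "distinct (map set (map (\<lambda>v. v # T) e))"
      using assms(3) by (simp add: distinct_map comp_def)
    then show ?thesis using True by (simp add: berge_step_def extensions_def distinct_map_filter)
  qed (simp add: berge_step_def)
  moreover have "set ` set (berge_step D' e [T]) \<inter> set ` set (berge_step D' e Ts) = {}"
  proof (rule ccontr)
    assume "\<not> ?thesis"
    then obtain S S' where S: "S \<in> set (berge_step D' e [T])" "S' \<in> set (berge_step D' e Ts)" "set S = set S'"
      by blast
    have "?origin (set S) = set T" using origin[of "[T]" S] Cons.prems(1) S(1) by simp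
    then have "?origin (set S') = set T" unfolding S(3) .
    moreover obtain T' where T': "T' \<in> set Ts" "?origin (set S') = set T'"
      using origin[of Ts S'] Cons.prems(1) S(2) by (meson list.set_intros(2))
    ultimately have "set T = set T'" by metis
    then show False using T'(1) Cons.prems(2) by simp
  qed
  ultimately show ?case using Cons unfolding step by simp
qed

lemma lists_family_berge_step:
  assumes "lists_family Ts {S. minimal_hitting_set V (set ` set D) S}" "set e \<subseteq> V" "distinct e"
  shows "lists_family (berge_step (e # D) e Ts) {S. minimal_hitting_set V (set ` set (e # D)) S}"
proof -
  have Ts: "\<forall>T\<in>set Ts. distinct T" "distinct (map set Ts)"
    "set ` set Ts = {S. minimal_hitting_set V (set ` set D) S}"
    using assms(1) unfolding lists_family_def lists_set_def by auto
  then have m: "\<forall>T\<in>set Ts. minimal_hitting_set V (set ` set D) (set T)" by blast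
  have "distinct S" if "S \<in> set (berge_step (e # D) e Ts)" for S
    using that Ts(1) unfolding set_berge_step by (auto split: if_splits)
  moreover have "set ` set (berge_step (e # D) e Ts) = {S. minimal_hitting_set V (set ` set (e # D)) S}"
    using berge_step_sound[OF m assms(2)] berge_step_complete[of V D Ts e] Ts(3) by blast
  ultimately show ?thesis
    using distinct_berge_step[OF m Ts(2) assms(3)] unfolding lists_family_def lists_set_def by simp
qed

lemma lists_family_berge:
  assumes "lists_family Ts {S. minimal_hitting_set V (set ` set D) S}" "\<forall>e\<in>set es. set e \<subseteq> V \<and> distinct e"
  shows "lists_family (berge D es Ts) {S. minimal_hitting_set V (set ` (set D \<union> set es)) S}"
  using assms
proof (induction es arbitrary: D Ts)
  case (Cons e es)
  then show ?case using Cons.IH[OF lists_family_berge_step[of Ts V D e]] by simp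
qed simp

section \<open>Number of edges and total running time\<close>

text \<open>The time bound may depend on the number of vertices only. A nonempty edge is
  \<open>{a, b, c}\<close> with repetitions allowed, so there are at most n^3 + 1 edges.\<close>

lemma card_edges_le:
  assumes "rank3 V E"
  shows "card E \<le> (card V + 1) ^ 3"
proof -
  let ?f = "\<lambda>(a, b, c). {a, b, c}"
  have fin: "finite V" using rank3D(1)[OF assms] .
  have "E \<subseteq> insert {} (?f ` (V \<times> V \<times> V))"
  proof
    fix e assume e: "e \<in> E"
    have V: "e \<subseteq> V" and c: "card e \<le> 3" using rank3D(2,3)[OF assms e] by auto
    have "finite e" using V fin finite_subset by blast
    then have "card e = 0 \<longleftrightarrow> e = {}" by simp
    with c consider "e = {}" | "card e = 1" | "card e = 2" | "card e = 3" by linarith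
    then show "e \<in> insert {} (?f ` (V \<times> V \<times> V))"
    proof cases
      case 2
      then obtain a where "e = {a}" by (auto simp: card_1_singleton_iff)
      then show ?thesis using V by (intro insertI2 image_eqI[of _ _ "(a, a, a)"]) auto
    next
      case 3
      then obtain a b where "e = {a, b}" by (auto simp: card_2_iff)
      then show ?thesis using V by (intro insertI2 image_eqI[of _ _ "(a, a, b)"]) auto
    next
      case 4
      then obtain a b c where "e = {a, b, c}" by (auto simp: card_3_iff)
      then show ?thesis using V by (intro insertI2 image_eqI[of _ _ "(a, b, c)"]) auto
    qed simp
  qed
  then have "card E \<le> card (insert {} (?f ` (V \<times> V \<times> V)))"
    using fin by (intro card_mono) auto
  also have "\<dots> \<le> Suc (card (?f ` (V \<times> V \<times> V)))" by (rule card_insert_le_m1) simp_all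
  also have "\<dots> \<le> Suc (card (V \<times> V \<times> V))" using fin by (intro Suc_le_mono[THEN iffD2] card_image_le) simp
  also have "\<dots> \<le> (card V + 1) ^ 3" by (simp add: card_cartesian_product power3_eq_cube algebra_simps)
  finally show ?thesis .
qed

definition steps :: "nat \<Rightarrow> nat" where
  "steps n = loop_cost (n + 1) ((n + 1) ^ 3) (nat \<lceil>(147/89 :: real) ^ n\<rceil>) * ((n + 1) ^ 3 + 1) + 9"

text \<open>Each prefix of the edge list is again a rank 3 hypergraph on \<open>V\<close>, so the
  counting bound controls every intermediate family.\<close>

lemma berge_program_enumerates: "enumerates_minimal_hitting_sets 3 berge_program steps"
  unfolding enumerates_minimal_hitting_sets_def
proof (intro allI impI)
  fix V :: "nat set" and E vs es
  assume asm: "hypergraph V E \<and> has_rank 3 E \<and> lists_set vs V \<and> lists_family es E"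
  then have r: "rank3 V E" and E: "set ` set es = E" "distinct (map set es)" "\<forall>e\<in>set es. distinct e"
    unfolding rank3_def lists_family_def lists_set_def by auto
  have fin: "finite V" using rank3D(1)[OF r] .
  have eV: "\<forall>e\<in>set es. set e \<subseteq> V \<and> distinct e" using rank3D(2)[OF r] E by blast
  have init: "lists_family [[]] {S. minimal_hitting_set V (set ` set []) S}"
    by (auto simp: lists_family_def lists_set_def minimal_hitting_set_iff_private hitting_set_def)
  let ?N = "card V + 1" and ?M = "(card V + 1) ^ 3" and ?R = "nat \<lceil>(147/89 :: real) ^ card V\<rceil>"
  have short: "length xs \<le> card V" if "distinct xs" "set xs \<subseteq> V" for xs
    using distinct_card[OF that(1)] card_mono[OF fin that(2)] by simp
  have family: "lists_family (berge [] es1 [[]]) {S. minimal_hitting_set V (set ` set es1) S}"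
    if "es = es1 @ es2" for es1 es2
    using lists_family_berge[OF init, of es1] eV that by simp
  have len_es: "length es \<le> ?M"
    using card_edges_le[OF r] distinct_card[OF E(2)] E(1) by simp
  have "evaluates berge_program [sexp_of_family es, sexp_of_family [], sexp_of_family [[]]] loop_body
    (sexp_of_family (berge [] es [[]])) (loop_cost ?N ?M ?R * (length es + 1))"
  proof (rule evaluates_loop)
    fix es1 es2 assume es: "es = es1 @ es2"
    note F = family[OF es, unfolded lists_family_def lists_set_def]
    have "set ` set es1 \<subseteq> E" using E(1) es by auto
    then have "rank3 V (set ` set es1)"
      using r unfolding rank3_def hypergraph_def has_rank_def by blast
    from card_minimal_hitting_sets_le[OF this]
    have "real (length (berge [] es1 [[]])) \<le> (147/89) ^ card V"
      using F distinct_card[of "map set (berge [] es1 [[]])"] by simp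
    then show "length (berge [] es1 [[]]) \<le> ?R" by linarith
    fix T assume T: "T \<in> set (berge [] es1 [[]])"
    then have "minimal_hitting_set V (set ` set es1) (set T)" using F by auto
    then have "set T \<subseteq> V" unfolding minimal_hitting_set_def hitting_set_def by blast
    then show "length T + 1 \<le> ?N" using short F T by auto
  next
    show "\<forall>e\<in>set [] \<union> set es. length e \<le> ?N" using short eV by (auto intro: le_SucI)
  qed (use len_es in simp)
  then have "evaluates berge_program [sexp_of_family es, Null, Dot Null Null] loop_body
    (sexp_of_family (berge [] es [[]])) (loop_cost ?N ?M ?R * (length es + 1))"
    unfolding sexp_simps .
  from evaluates_imp_runs[OF this, of vs]
  obtain t where t: "runs berge_program (sexp_of_hypergraph vs es) (sexp_of_family (berge [] es [[]])) t"
    "t \<le> loop_cost ?N ?M ?R * (length es + 1) + 9" by blast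
  have "loop_cost ?N ?M ?R * (length es + 1) \<le> loop_cost ?N ?M ?R * (?M + 1)"
    using len_es by (intro mult_le_mono) simp_all
  then have "t \<le> steps (card V)" using t(2) unfolding steps_def by linarith
  then show "\<exists>out t. runs berge_program (sexp_of_hypergraph vs es) (sexp_of_family out) t \<and>
      lists_family out {S. minimal_hitting_set V E S} \<and> t \<le> steps (card V)"
    using t(1) family[of es "[]"] E(1) by auto
qed

text \<open>The step count is a polynomial times (147/89)^n, up to lower-order terms, and 147/89 <
  1.6627 leaves room for the polynomial.\<close>

lemma steps_bigo: "(\<lambda>n. real (steps n)) \<in> O(\<lambda>n. (1.6627 :: real) ^ n)"
proof -
  let ?s = "\<lambda>n. real (step_cost (n + 1) ((n + 1) ^ 3))"
  have "(\<lambda>n. real (steps n)) \<in> O(\<lambda>n. (?s n * ((147/89) ^ n + 2) + 30) * ((real n + 1) ^ 3 + 1) + 9)"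
  proof (rule landau_o.big_mono, rule always_eventually, rule allI)
    fix n
    \<comment> \<open>Rounding up costs at most 1; this removes the ceiling before the asymptotic
      comparison.\<close>
    have "real (nat \<lceil>(147/89 :: real) ^ n\<rceil>) + 1 \<le> (147/89) ^ n + 2"
      by (simp add: of_nat_nat) linarith
    then have "?s n * (real (nat \<lceil>(147/89 :: real) ^ n\<rceil>) + 1) \<le> ?s n * ((147/89) ^ n + 2)"
      by (intro mult_left_mono) simp_all
    then have "(?s n * (real (nat \<lceil>(147/89 :: real) ^ n\<rceil>) + 1) + 30) * ((real n + 1) ^ 3 + 1) + 9
        \<le> (?s n * ((147/89) ^ n + 2) + 30) * ((real n + 1) ^ 3 + 1) + 9"
      by (intro add_right_mono mult_right_mono) simp_all
    then have "real (steps n) \<le> (?s n * ((147/89) ^ n + 2) + 30) * ((real n + 1) ^ 3 + 1) + 9"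
      unfolding steps_def loop_cost_def of_nat_add of_nat_mult of_nat_power of_nat_1 of_nat_numeral .
    then show "norm (real (steps n)) \<le> norm ((?s n * ((147/89) ^ n + 2) + 30) * ((real n + 1) ^ 3 + 1) + 9)"
      by simp
  qed
  also have "(\<lambda>n. (?s n * ((147/89) ^ n + 2) + 30) * ((real n + 1) ^ 3 + 1) + 9) \<in> O(\<lambda>n. (1.6627 :: real) ^ n)"
    unfolding step_cost_def extend_cost_def minimal_cost_def hits_cost_def of_nat_add of_nat_mult of_nat_power
    by real_asymp
  finally show ?thesis .
qed

theorem theorem9:
  "\<exists>(P :: program) (T :: nat \<Rightarrow> nat).
     enumerates_minimal_hitting_sets 3 P T \<and>
     (\<lambda>n. real (T n)) \<in> O(\<lambda>n. (1.6627 :: real) ^ n)"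
  using berge_program_enumerates steps_bigo by blast

end
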